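(* Let $f:\mathcal{M}\to\mathbb{R}$ be $\mathcal{C}^1$-smooth and let $L>0$. Suppose: (1) (descent condition) $f(\mathcal{R}_x(\eta))\le f(x)+\langle \mathrm{grad} f(x),\eta\rangle_x+\frac{L}{2}\|\eta\|^2$ for all $x\in\mathcal{M}$, $\eta\in T_x\mathcal{M}$; (2) (Lipschitz gradient) $\|\mathcal{T}_y^x\,\mathrm{grad} f(y)-\mathrm{grad} f(x)\|\le L\|\eta\|$ for all $x\in\mathcal{M}$, $\eta\in T_x\mathcal{M}$, where $y=\mathcal{R}_x(\eta)$. Let $\{t_k\}_{k\ge1}\subset(0,\infty)$ and $\{\epsilon_k\}_{k\ge1}\subset(0,\infty)$ satisfy $$\sum_{k=1}^\infty t_k=\infty,\quad t_k\downarrow 0,\quad \sum_{k=1}^\infty t_k\epsilon_k<\infty,\quad \limsup_{k\to\infty}\epsilon_k<2.$$ Let $\{x_k\}_{k\ge 1}\subset\mathcal{M}$ be a sequence generated by $$x_{k+1}=\mathcal{R}_{x_k}(-t_kg_k),\quad g_k\in T_{x_k}\mathcal{M},\quad \|g_k-\mathrm{grad} f(x_k)\|\le\epsilon_k,\qquad k=1,2,\ldots,$$ with $\inf_k f(x_k)>-\infty$. Let $\mathcal{S}$ be the set of all accumulation points of $\{x_k\}$ and let $\bar x\in\mathcal{S}$. Suppose that $f$ satisfies the Riemannian KL property at every point of $\mathcal{S}$ with a desingularizing function $\varphi:[0,\delta)\to[0,\infty)$ for which there is some $C>0$ such that $$C[\varphi'(x+y)]^{-1}\le(\varphi'(x))^{-1}+(\varphi'(y))^{-1}\quad\text{whenever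 } x,y\in(0,\delta),\ x+y<\delta.$$ Assume in addition that $$\sum_{k=1}^\infty t_k\Big(\varphi'\Big(\sum_{i=k}^\infty t_i\epsilon_i\Big)\Big)^{-1}<\infty$$ (only those $k$ with $\sum_{i=k}^\infty t_i\epsilon_i<\delta$ being included in the outer sum), and that $f(x_k)>f(\bar x)$ for all sufficiently large $k\in\mathbb{N}$. Then $x_k\to\bar x$ as $k\to\infty$. In particular, if (without assuming $f(x_k)>f(\bar x)$ for large $k$) $\bar x$ is a global minimizer of $f$, then either $f(x_k)=f(\bar x)$ for some $k\in\mathbb{N}$, or $x_k\to\bar x$.
   Context: $\mathcal{M}\subset\mathbb{R}^n$ is a Riemannian submanifold embedded in $\mathbb{R}^n$, with inner product $\langle\cdot,\cdot\rangle_x$ on $T_x\mathcal{M}$ varying smoothly in $x$ and induced norm $\|\cdot\|$ on tangent vectors; for points of $\mathcal{M}$, $\|x-y\|$ is the Euclidean norm in $\mathbb{R}^n$. The Riemannian gradient $\mathrm{grad} f(x)\in T_x\mathcal{M}$ is the unique tangent vector with $\langle\mathrm{grad} f(x),\xi\rangle_x=Df(x)[\xi]$ for all $\xi\in T_x\mathcal{M}$. $\mathcal{R}:T\mathcal{M}\to\mathcal{M}$ is a retraction: a smooth map whose restriction $\mathcal{R}_x$ to $T_x\mathcal{M}$ satisfies $\mathcal{R}_x(0_x)=x$ and $D\mathcal{R}_x(0_x)=\mathrm{id}_{T_x\mathcal{M}}$. Standing assumption on the retraction: there is a constant $\kappa>0$ with $\|\mathcal{R}_x(\eta)-x\|\le\kappa\|\eta\|$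 for all $x\in\mathcal{M}$, $\eta\in T_x\mathcal{M}$. $\mathcal{T}$ is a vector transport: a smooth map $(\eta_x,\xi_x)\mapsto\mathcal{T}_{\eta_x}(\xi_x)\in T_{\mathcal{R}_x(\eta_x)}\mathcal{M}$, linear in $\xi_x$, with $\mathcal{T}_{0_x}\xi_x=\xi_x$; it is isometric: $\langle\mathcal{T}_{\eta_x}\xi_x,\mathcal{T}_{\eta_x}\zeta_x\rangle_{\mathcal{R}_x(\eta_x)}=\langle\xi_x,\zeta_x\rangle_x$. For $y=\mathcal{R}_x(\eta)$, $\mathcal{T}_y^x:T_y\mathcal{M}\to T_x\mathcal{M}$ denotes $\mathcal{T}_\eta^{-1}$. $t_k\downarrow0$ means that $t_k$ decreases to $0$. Accumulation points are taken in $\mathcal{M}$. Riemannian KL (Kurdyka-Łojasiewicz) property of $f$ at $\bar x$: there exist $\delta\in(0,\infty]$, a neighborhood $U\subset\mathcal{M}$ of $\bar x$, and a concave continuous function $\varphi:[0,\delta)\to[0,\infty)$ (the desingularizing function) such that $\varphi(0)=0$, $\varphi$ is $\mathcal{C}^1$ on $(0,\delta)$, $\varphi'>0$ on $(0,\delta)$, and $\varphi'(f(x)-f(\bar x))\|\mathrm{grad} f(x)\|\ge1$ for all $x\in U$ with $f(\bar x)<f(x)<f(\bar x)+\delta$. *)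

theory Defs
  imports "HOL-Analysis.Analysis"
begin

section \<open>Smooth maps\<close>

text \<open>\<open>Cn_on n g U\<close> is meant for open \<open>U\<close>: all iterated directional derivatives of order up to
  \<open>n\<close> exist and are continuous on \<open>U\<close>, and those of order below \<open>n\<close> are Frechet differentiable.\<close>

primrec Cn_on :: "nat \<Rightarrow> ('a::euclidean_space \<Rightarrow> 'b::real_normed_vector) \<Rightarrow> 'a set \<Rightarrow> bool" where
  "Cn_on 0 g U \<longleftrightarrow> continuous_on U g"
| "Cn_on (Suc n) g U \<longleftrightarrow>
     (\<forall>x\<in>U. g differentiable (at x)) \<and>
     (\<forall>v. Cn_on n (\<lambda>x. frechet_derivative g (at x) v) U)"

definition C_on :: "enat \<Rightarrow> ('a::euclidean_space \<Rightarrow> 'b::real_normed_vector) \<Rightarrow> 'a set \<Rightarrow> bool" where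
  "C_on k g U \<longleftrightarrow> (\<forall>n. enat n \<le> k \<longrightarrow> Cn_on n g U)"

text \<open>A map on a subset of a Euclidean space (such as an embedded submanifold or its tangent
  bundle) is \<open>C\<close>-\<open>k\<close> if around each point it has a \<open>C\<close>-\<open>k\<close> extension to an open set of the
  ambient space.\<close>

definition C_map :: "enat \<Rightarrow> 'a::euclidean_space set \<Rightarrow> ('a \<Rightarrow> 'b::real_normed_vector) \<Rightarrow> bool" where
  "C_map k M f \<longleftrightarrow>
     (\<forall>x\<in>M. \<exists>U g. open U \<and> x \<in> U \<and> C_on k g U \<and> (\<forall>y\<in>U \<inter> M. g y = f y))"


section \<open>Embedded submanifolds and their tangent spaces\<close>

text \<open>Existence of a smooth slice chart around each point, with the same dimension throughout.\<close>

definition embedded_submanifold :: "'a::euclidean_space set \<Rightarrow> bool" where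
  "embedded_submanifold M \<longleftrightarrow>
     (\<exists>d. \<forall>x\<in>M. \<exists>U V S. \<exists>(\<Phi> :: 'a \<Rightarrow> 'a) \<Psi>.
        open U \<and> x \<in> U \<and> open V \<and>
        C_on \<infinity> \<Phi> U \<and> C_on \<infinity> \<Psi> V \<and> homeomorphism U V \<Phi> \<Psi> \<and>
        subspace S \<and> dim S = d \<and> \<Phi> ` (U \<inter> M) = V \<inter> S)"

definition curve_through :: "'a::euclidean_space set \<Rightarrow> 'a \<Rightarrow> 'a \<Rightarrow> (real \<Rightarrow> 'a) \<Rightarrow> bool" where
  "curve_through M x v c \<longleftrightarrow>
     (\<exists>e>0. C_on \<infinity> c {-e<..<e} \<and> c ` {-e<..<e} \<subseteq> M) \<and>
     c 0 = x \<and> (c has_vector_derivative v) (at 0)"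

definition tangent_space :: "'a::euclidean_space set \<Rightarrow> 'a \<Rightarrow> 'a set" where
  "tangent_space M x = {v. \<exists>c. curve_through M x v c}"

definition tangent_bundle :: "'a::euclidean_space set \<Rightarrow> ('a \<times> 'a) set" where
  "tangent_bundle M = {(x, v). x \<in> M \<and> v \<in> tangent_space M x}"

text \<open>The Whitney sum of the tangent bundle with itself: pairs of tangent vectors with a common
  base point. Metrics and vector transports are maps on this set.\<close>

definition tangent_bundle2 :: "'a::euclidean_space set \<Rightarrow> ('a \<times> 'a \<times> 'a) set" where
  "tangent_bundle2 M = {(x, u, v). x \<in> M \<and> u \<in> tangent_space M x \<and> v \<in> tangent_space M x}"


section \<open>Riemannian metric and gradient\<close>

definition riemannian_metric ::
    "'a::euclidean_space set \<Rightarrow> ('a \<Rightarrow> 'a \<Rightarrow> 'a \<Rightarrow> real) \<Rightarrow> bool" where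
  "riemannian_metric M ip \<longleftrightarrow>
     (\<forall>x\<in>M. \<forall>u\<in>tangent_space M x. \<forall>v\<in>tangent_space M x.
        ip x u v = ip x v u \<and>
        (\<forall>w\<in>tangent_space M x. \<forall>a b. ip x (a *\<^sub>R u + b *\<^sub>R v) w = a * ip x u w + b * ip x v w)) \<and>
     (\<forall>x\<in>M. \<forall>u\<in>tangent_space M x. u \<noteq> 0 \<longrightarrow> ip x u u > 0) \<and>
     C_map \<infinity> (tangent_bundle2 M) (\<lambda>(x, u, v). ip x u v)"

definition rnorm :: "('a \<Rightarrow> 'a \<Rightarrow> 'a \<Rightarrow> real) \<Rightarrow> 'a \<Rightarrow> 'a \<Rightarrow> real" where
  "rnorm ip x v = sqrt (ip x v v)"

text \<open>For differentiable \<open>f\<close> and tangent \<open>\<xi>\<close> this is \<open>Df(x)[\<xi>]\<close>, the derivative of \<open>f\<close> along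
  any curve in \<open>M\<close> through \<open>x\<close> with velocity \<open>\<xi>\<close>.\<close>

definition differential :: "'a::euclidean_space set \<Rightarrow> ('a \<Rightarrow> real) \<Rightarrow> 'a \<Rightarrow> 'a \<Rightarrow> real" where
  "differential M f x \<xi> =
     (THE d. \<forall>c. curve_through M x \<xi> c \<longrightarrow> ((f \<circ> c) has_real_derivative d) (at 0))"

definition rgrad ::
    "'a::euclidean_space set \<Rightarrow> ('a \<Rightarrow> 'a \<Rightarrow> 'a \<Rightarrow> real) \<Rightarrow> ('a \<Rightarrow> real) \<Rightarrow> 'a \<Rightarrow> 'a" where
  "rgrad M ip f x =
     (THE g. g \<in> tangent_space M x \<and> (\<forall>\<xi>\<in>tangent_space M x. ip x g \<xi> = differential M f x \<xi>))"


section \<open>Retractions and vector transports\<close>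

text \<open>\<open>R x \<eta>\<close> stands for the retraction at \<open>x\<close> applied to the tangent vector \<open>\<eta>\<close> at \<open>x\<close>, and
  \<open>T x \<eta> \<xi>\<close> for the transport along \<open>\<eta>\<close> of the tangent vector \<open>\<xi>\<close> at \<open>x\<close>; values at
  non-tangent arguments are irrelevant.\<close>

definition manifold_retraction :: "'a::euclidean_space set \<Rightarrow> ('a \<Rightarrow> 'a \<Rightarrow> 'a) \<Rightarrow> bool" where
  "manifold_retraction M R \<longleftrightarrow>
     (\<forall>x\<in>M. \<forall>\<eta>\<in>tangent_space M x. R x \<eta> \<in> M) \<and>
     C_map \<infinity> (tangent_bundle M) (\<lambda>(x, \<eta>). R x \<eta>) \<and>
     (\<forall>x\<in>M. R x 0 = x \<and> (R x has_derivative (\<lambda>\<xi>. \<xi>)) (at 0 within tangent_space M x))"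

definition vector_transport ::
    "'a::euclidean_space set \<Rightarrow> ('a \<Rightarrow> 'a \<Rightarrow> 'a) \<Rightarrow> ('a \<Rightarrow> 'a \<Rightarrow> 'a \<Rightarrow> 'a) \<Rightarrow> bool" where
  "vector_transport M R T \<longleftrightarrow>
     (\<forall>x\<in>M. \<forall>\<eta>\<in>tangent_space M x. \<forall>\<xi>\<in>tangent_space M x.
        T x \<eta> \<xi> \<in> tangent_space M (R x \<eta>)) \<and>
     C_map \<infinity> (tangent_bundle2 M) (\<lambda>(x, \<eta>, \<xi>). T x \<eta> \<xi>) \<and>
     (\<forall>x\<in>M. \<forall>\<eta>\<in>tangent_space M x. \<forall>\<xi>\<in>tangent_space M x. \<forall>\<zeta>\<in>tangent_space M x. \<forall>a b.
        T x \<eta> (a *\<^sub>R \<xi> + b *\<^sub>R \<zeta>) = a *\<^sub>R T x \<eta> \<xi> + b *\<^sub>R T x \<eta> \<zeta>) \<and>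
     (\<forall>x\<in>M. \<forall>\<xi>\<in>tangent_space M x. T x 0 \<xi> = \<xi>)"

definition isometric_transport ::
    "'a::euclidean_space set \<Rightarrow> ('a \<Rightarrow> 'a \<Rightarrow> 'a \<Rightarrow> real) \<Rightarrow> ('a \<Rightarrow> 'a \<Rightarrow> 'a) \<Rightarrow>
     ('a \<Rightarrow> 'a \<Rightarrow> 'a \<Rightarrow> 'a) \<Rightarrow> bool" where
  "isometric_transport M ip R T \<longleftrightarrow>
     (\<forall>x\<in>M. \<forall>\<eta>\<in>tangent_space M x. \<forall>\<xi>\<in>tangent_space M x. \<forall>\<zeta>\<in>tangent_space M x.
        ip (R x \<eta>) (T x \<eta> \<xi>) (T x \<eta> \<zeta>) = ip x \<xi> \<zeta>)"

text \<open>The inverse transport from the tangent space at \<open>R x \<eta>\<close> back to the one at \<open>x\<close>.\<close>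

definition back_transport ::
    "'a::euclidean_space set \<Rightarrow> ('a \<Rightarrow> 'a \<Rightarrow> 'a \<Rightarrow> 'a) \<Rightarrow> 'a \<Rightarrow> 'a \<Rightarrow> 'a \<Rightarrow> 'a" where
  "back_transport M T x \<eta> = inv_into (tangent_space M x) (T x \<eta>)"


section \<open>The KL property\<close>

text \<open>\<open>\<phi>\<close> is a total function of which only the values on \<open>[0, \<delta>)\<close> matter.\<close>

definition desingularizing :: "ereal \<Rightarrow> (real \<Rightarrow> real) \<Rightarrow> bool" where
  "desingularizing \<delta> \<phi> \<longleftrightarrow>
     0 < \<delta> \<and>
     (\<forall>s. 0 \<le> s \<and> ereal s < \<delta> \<longrightarrow> 0 \<le> \<phi> s) \<and>
     concave_on {s. 0 \<le> s \<and> ereal s < \<delta>} \<phi> \<and>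
     continuous_on {s. 0 \<le> s \<and> ereal s < \<delta>} \<phi> \<and>
     \<phi> 0 = 0 \<and>
     (\<forall>s. 0 < s \<and> ereal s < \<delta> \<longrightarrow> \<phi> differentiable (at s) \<and> deriv \<phi> s > 0) \<and>
     continuous_on {s. 0 < s \<and> ereal s < \<delta>} (deriv \<phi>)"

definition riemannian_KL_with ::
    "'a::euclidean_space set \<Rightarrow> ('a \<Rightarrow> 'a \<Rightarrow> 'a \<Rightarrow> real) \<Rightarrow> ('a \<Rightarrow> real) \<Rightarrow> 'a \<Rightarrow>
     ereal \<Rightarrow> (real \<Rightarrow> real) \<Rightarrow> bool" where
  "riemannian_KL_with M ip f z \<delta> \<phi> \<longleftrightarrow>
     desingularizing \<delta> \<phi> \<and>
     (\<exists>U. openin (top_of_set M) U \<and> z \<in> U \<and>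
        (\<forall>x\<in>U. f z < f x \<and> ereal (f x) < ereal (f z) + \<delta> \<longrightarrow>
           deriv \<phi> (f x - f z) * rnorm ip x (rgrad M ip f x) \<ge> 1))"


section \<open>Accumulation points\<close>

text \<open>Limits in \<open>M\<close> of subsequences; whether a term with index \<open>0\<close> is counted does not matter.\<close>

definition accumulation_points :: "'a::topological_space set \<Rightarrow> (nat \<Rightarrow> 'a) \<Rightarrow> 'a set" where
  "accumulation_points M x = {z \<in> M. \<exists>r. strict_mono r \<and> (x \<circ> r) \<longlonglongrightarrow> z}"

end

theory Submission
  imports Defs
begin

text \<open>Put \<open>u k = (\<Sum>i\<ge>k. t i * \<epsilon> i)\<close> and \<open>\<Delta> k = f (x k) - f xbar + u k\<close>. Since the errors are eventually
  at most \<open>2\<close>, the descent condition gives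
  \<open>\<Delta> (k + 1) \<le> \<Delta> k - t k / 2 * (norm (grad f (x k)))\<^sup>2\<close>, so \<open>\<Delta>\<close> decreases to \<open>0\<close>. Concavity of \<open>\<phi>\<close>
  turns this into a lower bound of \<open>\<phi> (\<Delta> k) - \<phi> (\<Delta> (k + 1))\<close>. The quasi-subadditivity of
  \<open>1 / \<phi>'\<close> together with the KL inequality bounds \<open>C / \<phi>' (\<Delta> k)\<close> by
  \<open>norm (grad f (x k)) + 1 / \<phi>' (u k)\<close>, as long as \<open>x k\<close> is near \<open>xbar\<close>; hence
  \<open>t k * norm (grad f (x k)) \<le> 2 / C * (\<phi> (\<Delta> k) - \<phi> (\<Delta> (k + 1))) + t k / \<phi>' (u k)\<close>.
  The right-hand side has arbitrarily small tails, so an iterate close to the accumulation point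
  \<open>xbar\<close> traps all later iterates near \<open>xbar\<close>.\<close>

subsection \<open>Tangent spaces and the gradient\<close>

lemma Cn_on_cong:
  assumes "open U" "\<And>y. y \<in> U \<Longrightarrow> g y = h y" "Cn_on n g U"
  shows "Cn_on n h U"
  using assms(2,3)
proof (induction n arbitrary: g h)
  case 0
  then show ?case by (simp cong: continuous_on_cong)
next
  case (Suc n)
  have diff: "g differentiable (at y)" if "y \<in> U" for y
    using Suc.prems(2) that by simp
  have "h differentiable (at y)" if "y \<in> U" for y
    using diff[OF that] has_derivative_transform_within_open[of g _ y UNIV U h]
      assms(1) that Suc.prems(1)
    unfolding differentiable_def by blast
  moreover have "Cn_on n (\<lambda>y. frechet_derivative h (at y) v) U" for v
  proof (rule Suc.IH)
    show "Cn_on n (\<lambda>y. frechet_derivative g (at y) v) U"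
      using Suc.prems(2) by simp
    show "frechet_derivative g (at y) v = frechet_derivative h (at y) v" if "y \<in> U" for y
      using frechet_derivative_transform_within_open[OF diff[OF that] assms(1) that Suc.prems(1)]
      by simp
  qed
  ultimately show ?case by simp
qed

text \<open>Along a line, the derivative of the composite is again such a composite:
  \<open>h\<close> is replaced by its directional derivative in a multiple of \<open>s\<close>.
  Hence induction over the order works with \<open>h\<close> arbitrary, and no chain rule of higher
  order arises. This supplies smooth curves for the tangent spaces.\<close>

lemma Cn_on_along_line:
  fixes h :: "'a::euclidean_space \<Rightarrow> 'b::real_normed_vector" and A :: "real set"
  assumes "open A" "\<And>t. t \<in> A \<Longrightarrow> p + t *\<^sub>R s \<in> V" "Cn_on n h V"
  shows "Cn_on n (\<lambda>t. h (p + t *\<^sub>R s)) A"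
  using assms(3)
proof (induction n arbitrary: h)
  case 0
  then have "continuous_on V h" by simp
  moreover have "continuous_on A (\<lambda>t. p + t *\<^sub>R s)"
    by (intro continuous_intros)
  ultimately have "continuous_on A (\<lambda>t. h (p + t *\<^sub>R s))"
    by (rule continuous_on_compose2) (use assms(2) in auto)
  then show ?case by simp
next
  case (Suc n)
  define D where "D t = frechet_derivative h (at (p + t *\<^sub>R s))" for t
  have D: "((\<lambda>t. h (p + t *\<^sub>R s)) has_derivative (\<lambda>r. D t (r *\<^sub>R s))) (at t)" if "t \<in> A" for t
  proof -
    have "h differentiable (at (p + t *\<^sub>R s))"
      using Suc.prems assms(2)[OF that] by simp
    then have "(h has_derivative D t) (at (p + t *\<^sub>R s))"
      by (simp add: D_def frechet_derivative_works[symmetric])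
    moreover have "((\<lambda>t. p + t *\<^sub>R s) has_derivative (\<lambda>r. r *\<^sub>R s)) (at t)"
      by (auto intro!: derivative_eq_intros)
    ultimately show ?thesis
      using has_derivative_compose[of "\<lambda>t. p + t *\<^sub>R s" "\<lambda>r. r *\<^sub>R s" t UNIV h "D t"] by simp
  qed
  have "Cn_on n (\<lambda>t. frechet_derivative (\<lambda>t. h (p + t *\<^sub>R s)) (at t) v) A" for v
  proof (rule Cn_on_cong[OF assms(1)])
    show "Cn_on n (\<lambda>t. D t (v *\<^sub>R s)) A"
      unfolding D_def by (rule Suc.IH) (use Suc.prems in simp)
    show "D t (v *\<^sub>R s) = frechet_derivative (\<lambda>t. h (p + t *\<^sub>R s)) (at t) v" if "t \<in> A" for t
      using frechet_derivative_at[OF D[OF that]] by metis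
  qed
  then show ?case using D by (auto simp: differentiable_def)
qed

lemma C_on_differentiable:
  assumes "C_on k g U" "1 \<le> k" "y \<in> U"
  shows "g differentiable (at y)"
proof -
  have "Cn_on (Suc 0) g U"
    using assms(1,2) unfolding C_on_def by (auto simp: one_enat_def)
  then show ?thesis using assms(3) by simp
qed

section \<open>Tangent spaces of embedded submanifolds\<close>

text \<open>The difference quotients stay in \<open>S\<close>, and a subspace of a Euclidean space
  is closed, so their limit stays there as well.\<close>

lemma has_vector_derivative_in_subspace:
  fixes c :: "real \<Rightarrow> 'a::euclidean_space"
  assumes "subspace S" "(c has_vector_derivative v) (at a)" "\<forall>\<^sub>F s in at a. c s \<in> S" "c a \<in> S"
  shows "v \<in> S"
proof -
  let ?q = "\<lambda>s. (c s - c a) /\<^sub>R (s - a)"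
  have "((\<lambda>s. norm (c s - c a - (s - a) *\<^sub>R v) / norm (s - a)) \<longlongrightarrow> 0) (at a)"
    using assms(2) unfolding has_vector_derivative_def has_derivative_iff_norm by simp
  moreover have "\<forall>\<^sub>F s in at a.
      norm (c s - c a - (s - a) *\<^sub>R v) / norm (s - a) = norm (?q s - v)"
  proof -
    have "\<forall>\<^sub>F s in at a. s \<noteq> a" by (simp add: eventually_at_filter)
    then show ?thesis
    proof eventually_elim
      case (elim s)
      then have "?q s - v = (c s - c a - (s - a) *\<^sub>R v) /\<^sub>R (s - a)"
        by (simp add: scaleR_diff_right)
      then show ?case by (simp add: divide_inverse_commute)
    qed
  qed
  ultimately have "((\<lambda>s. norm (?q s - v)) \<longlongrightarrow> 0) (at a)"
    by (rule Lim_transform_eventually)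
  then have "(?q \<longlongrightarrow> v) (at a)"
    using tendsto_norm_zero_iff LIM_zero_iff by blast
  moreover have "\<forall>\<^sub>F s in at a. (c s - c a) /\<^sub>R (s - a) \<in> S"
    using assms(3) by eventually_elim (use assms(1,4) in \<open>simp add: subspace_scale subspace_diff\<close>)
  ultimately show ?thesis
    using Lim_in_closed_set[OF closed_subspace[OF assms(1)]] by (metis at_neq_bot)
qed

lemma curve_through_eventually:
  assumes "curve_through M y v c" "open U" "y \<in> U"
  shows "\<forall>\<^sub>F s in nhds 0. c s \<in> U \<inter> M"
proof -
  obtain e where e: "e > 0" "c ` {-e<..<e} \<subseteq> M" "c 0 = y" "(c has_vector_derivative v) (at 0)"
    using assms(1) unfolding curve_through_def by blast
  have "isCont c 0"
    using e(4) has_derivative_continuous unfolding has_vector_derivative_def by blast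
  then have "\<forall>\<^sub>F s in nhds 0. c s \<in> U"
    using assms(2,3) e(3) by (simp add: continuous_at_open eventually_nhds)
  moreover have "\<forall>\<^sub>F s in nhds 0. s \<in> {-e<..<e}"
    using e(1) by (intro eventually_nhds_in_open) auto
  ultimately show ?thesis
    by eventually_elim (use e(2) in auto)
qed

text \<open>A slice chart straightens \<open>M\<close> to the linear slice \<open>S\<close>, so the
  tangent space is the image of \<open>S\<close> under the derivative of the inverse chart, a linear
  map.\<close>

lemma tangent_space_subspace:
  fixes M :: "'a::euclidean_space set"
  assumes "embedded_submanifold M" "y \<in> M"
  shows "subspace (tangent_space M y)"
proof -
  obtain U V S and \<Phi> \<Psi> :: "'a \<Rightarrow> 'a" where ch:
    "open U" "y \<in> U" "open V" "C_on \<infinity> \<Phi> U" "C_on \<infinity> \<Psi> V" "homeomorphism U V \<Phi> \<Psi>"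
    "subspace S" "\<Phi> ` (U \<inter> M) = V \<inter> S"
    using assms unfolding embedded_submanifold_def by metis
  define p where "p = \<Phi> y"
  have pV: "p \<in> V" "p \<in> S" and \<Psi>p: "\<Psi> p = y"
    using ch(2,6,8) assms(2) unfolding p_def homeomorphism_def by auto
  obtain A B where A: "(\<Phi> has_derivative A) (at y)" and B: "(\<Psi> has_derivative B) (at p)"
    using C_on_differentiable[OF ch(4) _ ch(2)] C_on_differentiable[OF ch(5) _ pV(1)]
    unfolding differentiable_def by auto
  have BA: "B (A v) = v" for v
  proof -
    have "((\<lambda>z. \<Psi> (\<Phi> z)) has_derivative (\<lambda>v. B (A v))) (at y)"
      using has_derivative_compose[OF A, of \<Psi> B] B by (simp add: p_def)
    moreover have "((\<lambda>z. \<Psi> (\<Phi> z)) has_derivative (\<lambda>v. v)) (at y)"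
      by (rule has_derivative_transform_within_open[OF has_derivative_ident ch(1,2)])
         (use ch(6) in \<open>simp add: homeomorphism_def\<close>)
    ultimately show ?thesis
      using has_derivative_unique by metis
  qed
  have "tangent_space M y = B ` S"
  proof
    show "tangent_space M y \<subseteq> B ` S"
    proof
      fix v assume "v \<in> tangent_space M y"
      then obtain c where c: "curve_through M y v c"
        unfolding tangent_space_def by blast
      then have c0: "c 0 = y" and cv: "(c has_vector_derivative v) (at 0)"
        unfolding curve_through_def by auto
      have "((\<lambda>s. \<Phi> (c s)) has_vector_derivative A v) (at 0)"
        using has_derivative_compose[of c "\<lambda>r. r *\<^sub>R v" 0 UNIV \<Phi> A] cv A c0
          linear_scale[OF has_derivative_linear[OF A]]
        unfolding has_vector_derivative_def by simp
      moreover have "\<forall>\<^sub>F s in at 0. \<Phi> (c s) \<in> S"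
        using eventually_nhds_conv_at[THEN iffD1, OF curve_through_eventually[OF c ch(1,2)]] ch(8)
        by (auto elim!: eventually_mono)
      ultimately have "A v \<in> S"
        using has_vector_derivative_in_subspace[OF ch(7)] pV(2) c0 by (simp add: p_def)
      then show "v \<in> B ` S" using BA[of v] by (metis imageI)
    qed
    show "B ` S \<subseteq> tangent_space M y"
    proof clarify
      fix s assume s: "s \<in> S"
      \<comment> \<open>The straight line through \<open>p\<close> in the slice, pulled back by the
        inverse chart, is a curve in \<open>M\<close> with velocity \<open>B s\<close>.\<close>
      define c where "c t = \<Psi> (p + t *\<^sub>R s)" for t
      have "isCont (\<lambda>t. p + t *\<^sub>R s) 0" by (intro continuous_intros)
      then have "\<forall>\<^sub>F t in nhds 0. p + t *\<^sub>R s \<in> V"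
        using ch(3) pV(1) by (simp add: continuous_at_open eventually_nhds)
      then obtain e where e: "e > 0" "\<And>t::real. dist t 0 < e \<Longrightarrow> p + t *\<^sub>R s \<in> V"
        unfolding eventually_nhds_metric by blast
      have V: "p + t *\<^sub>R s \<in> V" if "t \<in> {-e<..<e}" for t
        using e(2)[of t] that by auto
      have "C_on \<infinity> c {-e<..<e}"
        unfolding C_on_def c_def
        using Cn_on_along_line[of "{-e<..<e}" p s V _ \<Psi>] V ch(5) by (simp add: C_on_def)
      moreover have "c t \<in> M" if "t \<in> {-e<..<e}" for t
      proof -
        have "p + t *\<^sub>R s \<in> V \<inter> S"
          using V[OF that] pV(2) s ch(7) by (simp add: subspace_add subspace_scale)
        then obtain z where "z \<in> U \<inter> M" "p + t *\<^sub>R s = \<Phi> z"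
          using ch(8) by (metis imageE)
        then show ?thesis using ch(6) by (simp add: c_def homeomorphism_def)
      qed
      moreover have "(c has_vector_derivative B s) (at 0)"
      proof -
        have "((\<lambda>t. p + t *\<^sub>R s) has_derivative (\<lambda>r. r *\<^sub>R s)) (at 0)"
          by (auto intro!: derivative_eq_intros)
        then show ?thesis
          using has_derivative_compose[of "\<lambda>t. p + t *\<^sub>R s" "\<lambda>r. r *\<^sub>R s" 0 UNIV \<Psi> B] B
            linear_scale[OF has_derivative_linear[OF B]]
          unfolding has_vector_derivative_def c_def by simp
      qed
      ultimately have "curve_through M y (B s) c"
        unfolding curve_through_def using e(1) \<Psi>p by (auto simp: c_def)
      then show "B s \<in> tangent_space M y"
        unfolding tangent_space_def by blast
    qed
  qed
  then show ?thesis
    using linear_subspace_image[OF has_derivative_linear[OF B] ch(7)] by simp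
qed

section \<open>Differentials and Riemannian gradients\<close>

text \<open>By the chain rule every admissible curve yields the value \<open>D \<xi>\<close>.
  Tangency of \<open>\<xi>\<close> provides at least one curve, without which the definite
  description would not be determined.\<close>

lemma differential_eq_derivative:
  assumes "open U" "y \<in> U" "(h has_derivative D) (at y)" "\<And>z. z \<in> U \<inter> M \<Longrightarrow> h z = f z"
    and "\<xi> \<in> tangent_space M y"
  shows "differential M f y \<xi> = D \<xi>"
proof -
  have D: "((f \<circ> c) has_real_derivative D \<xi>) (at 0)" if c: "curve_through M y \<xi> c" for c
  proof -
    have c0: "c 0 = y" and cv: "(c has_vector_derivative \<xi>) (at 0)"
      using c unfolding curve_through_def by auto
    have "((\<lambda>s. h (c s)) has_derivative (\<lambda>r. D (r *\<^sub>R \<xi>))) (at 0)"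
      using has_derivative_compose[of c "\<lambda>r. r *\<^sub>R \<xi>" 0 UNIV h D] cv assms(3) c0
      unfolding has_vector_derivative_def by simp
    then have "((\<lambda>s. h (c s)) has_real_derivative D \<xi>) (at 0)"
      using linear_scale[OF has_derivative_linear[OF assms(3)]]
      by (simp add: has_field_derivative_def mult_commute_abs)
    moreover have "\<forall>\<^sub>F s in nhds 0. h (c s) = (f \<circ> c) s"
      using curve_through_eventually[OF c assms(1,2)] by eventually_elim (use assms(4) in auto)
    ultimately show ?thesis
      using DERIV_cong_ev[of 0 0 "\<lambda>s. h (c s)" "f \<circ> c" "D \<xi>"] by simp
  qed
  obtain c where "curve_through M y \<xi> c"
    using assms(5) unfolding tangent_space_def by blast
  then show ?thesis
    unfolding differential_def using D by (intro the_equality) (auto dest: DERIV_unique)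
qed

text \<open>Gram-Schmidt by induction over a spanning set. The form is bilinear and positive only on
  \<open>W\<close>, so \<open>W\<close> stays fixed while \<open>B\<close> grows; \<open>l\<close>
  is generalised because the induction hypothesis serves two functionals, \<open>l\<close> itself
  and \<open>b e\<close>.\<close>

lemma riesz_representation_span:
  fixes b :: "'a::real_vector \<Rightarrow> 'a \<Rightarrow> real"
  assumes "subspace W"
    and sym: "\<And>u v. u \<in> W \<Longrightarrow> v \<in> W \<Longrightarrow> b u v = b v u"
    and lin: "\<And>u v w \<alpha> \<beta>. u \<in> W \<Longrightarrow> v \<in> W \<Longrightarrow> w \<in> W \<Longrightarrow>
      b (\<alpha> *\<^sub>R u + \<beta> *\<^sub>R v) w = \<alpha> * b u w + \<beta> * b v w"
    and pos: "\<And>u. u \<in> W \<Longrightarrow> u \<noteq> 0 \<Longrightarrow> b u u > 0"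
    and "finite B" "B \<subseteq> W"
    and l: "\<And>u v \<alpha> \<beta>. u \<in> W \<Longrightarrow> v \<in> W \<Longrightarrow> l (\<alpha> *\<^sub>R u + \<beta> *\<^sub>R v) = \<alpha> * l u + \<beta> * l v"
  shows "\<exists>g\<in>span B. \<forall>\<xi>\<in>span B. b g \<xi> = l \<xi>"
  using assms(5,6) l
proof (induction B arbitrary: l rule: finite_induct)
  case empty
  have "(0::'a) \<in> W" using assms(1) by (rule subspace_0)
  then show ?case using lin[of 0 0 0 0 0] empty.prems(2)[of 0 0 0 0] by simp
next
  case (insert e B)
  have e: "e \<in> W" and BW: "span B \<subseteq> W"
    using insert.prems(1) assms(1) by (auto intro: span_minimal[THEN subsetD])
  \<comment> \<open>Representing the functional \<open>b e\<close> yields the orthogonal projection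
    \<open>p\<close> of \<open>e\<close> onto \<open>span B\<close>.\<close>
  have "\<exists>p\<in>span B. \<forall>\<xi>\<in>span B. b p \<xi> = b e \<xi>"
  proof (rule insert.IH)
    show "b e (\<alpha> *\<^sub>R u + \<beta> *\<^sub>R v) = \<alpha> * b e u + \<beta> * b e v" if "u \<in> W" "v \<in> W" for u v \<alpha> \<beta>
      using lin[OF that e] sym[OF e] that assms(1)
      by (simp add: subspace_add subspace_scale)
  qed (use insert.prems in auto)
  then obtain p where p: "p \<in> span B" "\<And>\<xi>. \<xi> \<in> span B \<Longrightarrow> b p \<xi> = b e \<xi>" by blast
  obtain g where g: "g \<in> span B" "\<And>\<xi>. \<xi> \<in> span B \<Longrightarrow> b g \<xi> = l \<xi>"
    using insert.IH[of l] insert.prems by blast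
  define q where "q = e - p"
  have pW: "p \<in> W" and gW: "g \<in> W" using p g BW by auto
  have qW: "q \<in> W" using e pW assms(1) by (simp add: q_def subspace_diff)
  have perp: "b q \<xi> = 0" if "\<xi> \<in> span B" for \<xi>
    using lin[OF e pW, of \<xi> 1 "-1"] p(2)[OF that] that BW by (auto simp: q_def)
  \<comment> \<open>The coefficient is forced by \<open>b h q = l q\<close>. If \<open>e\<close>
    already lies in \<open>span B\<close>, then \<open>q = 0\<close> and the correction
    vanishes.\<close>
  define h where "h = g + (l q / b q q) *\<^sub>R q"
  have mono: "span B \<subseteq> span (insert e B)" by (rule span_mono) auto
  have qs: "q \<in> span (insert e B)"
    unfolding q_def using p(1) mono by (auto intro: span_diff span_base)
  have "h \<in> span (insert e B)"
    unfolding h_def using g(1) mono qs by (auto intro: span_add span_scale)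
  moreover have "b h \<xi> = l \<xi>" if \<xi>: "\<xi> \<in> span (insert e B)" for \<xi>
  proof -
    obtain k where k: "\<xi> - k *\<^sub>R e \<in> span B"
      using \<xi> by (auto simp: span_insert)
    \<comment> \<open>Rewriting \<open>e\<close> as \<open>p + q\<close> splits \<open>\<xi>\<close>
      into this component in \<open>span B\<close> and the orthogonal multiple
      \<open>k *\<^sub>R q\<close>.\<close>
    define z where "z = (\<xi> - k *\<^sub>R e) + k *\<^sub>R p"
    have z: "z \<in> span B" unfolding z_def using k p(1) by (intro span_add span_scale)
    have \<xi>_eq: "\<xi> = z + k *\<^sub>R q" by (simp add: z_def q_def algebra_simps)
    have zW: "z \<in> W" using z BW by auto
    have \<xi>W: "\<xi> \<in> W" using \<xi>_eq zW qW assms(1) by (simp add: subspace_add subspace_scale)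
    have hW: "h \<in> W" unfolding h_def using gW qW assms(1) by (simp add: subspace_add subspace_scale)
    have "b g q = 0" using sym[OF gW qW] perp[OF g(1)] by simp
    then have hq: "b h q = l q"
      using lin[OF gW qW qW, of 1 "l q / b q q"] pos[OF qW] lin[OF qW qW qW, of 0 0]
        insert.prems(2)[OF qW qW, of 0 0]
      by (cases "q = 0") (auto simp: h_def)
    have hz: "b h z = l z"
      using lin[OF gW qW zW, of 1 "l q / b q q"] perp[OF z] g(2)[OF z] by (simp add: h_def)
    have "b h \<xi> = b \<xi> h" by (rule sym[OF hW \<xi>W])
    also have "\<dots> = b z h + k * b q h"
      using lin[OF zW qW hW, of 1 k] by (simp add: \<xi>_eq)
    also have "\<dots> = l z + k * l q"
      using hq hz sym[OF zW hW] sym[OF qW hW] by simp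
    also have "\<dots> = l \<xi>"
      using insert.prems(2)[OF zW qW, of 1 k] by (simp add: \<xi>_eq)
    finally show ?thesis .
  qed
  ultimately show ?case by blast
qed

text \<open>\<open>rgrad\<close> is a definite description, so even tangency requires existence and
  uniqueness. Existence is the Riesz representation of the derivative of a local extension of
  \<open>f\<close>; uniqueness is positivity of the metric on the difference of two
  candidates.\<close>

lemma rgrad_in_tangent_space:
  fixes M :: "'a::euclidean_space set"
  assumes "embedded_submanifold M" "riemannian_metric M ip" "C_map 1 M f" "y \<in> M"
  shows "rgrad M ip f y \<in> tangent_space M y"
proof -
  let ?W = "tangent_space M y"
  have W: "subspace ?W" by (rule tangent_space_subspace[OF assms(1,4)])
  have sym: "\<And>u v. u \<in> ?W \<Longrightarrow> v \<in> ?W \<Longrightarrow> ip y u v = ip y v u"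
    and lin: "\<And>u v w \<alpha> \<beta>. u \<in> ?W \<Longrightarrow> v \<in> ?W \<Longrightarrow> w \<in> ?W \<Longrightarrow>
      ip y (\<alpha> *\<^sub>R u + \<beta> *\<^sub>R v) w = \<alpha> * ip y u w + \<beta> * ip y v w"
    and pos: "\<And>u. u \<in> ?W \<Longrightarrow> u \<noteq> 0 \<Longrightarrow> ip y u u > 0"
    using assms(2,4) unfolding riemannian_metric_def by metis+
  obtain U h where h: "open U" "y \<in> U" "C_on 1 h U" "\<forall>z\<in>U \<inter> M. h z = f z"
    using assms(3,4) unfolding C_map_def by metis
  obtain D where D: "(h has_derivative D) (at y)"
    using C_on_differentiable[OF h(3) _ h(2)] unfolding differentiable_def by auto
  have diff: "differential M f y \<xi> = D \<xi>" if "\<xi> \<in> ?W" for \<xi>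
    using differential_eq_derivative[OF h(1,2) D _ that] h(4) by blast
  obtain B where B: "finite B" "span B = ?W"
    using basis_exists[of ?W] W
    by (metis finiteI_independent span_subspace)
  have "B \<subseteq> ?W" using span_superset[of B] B(2) by simp
  have "D (\<alpha> *\<^sub>R u + \<beta> *\<^sub>R v) = \<alpha> * D u + \<beta> * D v" for u v \<alpha> \<beta>
    using has_derivative_linear[OF D] by (simp add: linear_add linear_scale)
  from riesz_representation_span[OF W sym lin pos B(1) \<open>B \<subseteq> ?W\<close> this]
  obtain G where G: "G \<in> ?W" "\<And>\<xi>. \<xi> \<in> ?W \<Longrightarrow> ip y G \<xi> = D \<xi>"
    unfolding B(2) by blast
  have uniq: "G' = G" if G': "G' \<in> ?W" "\<forall>\<xi>\<in>?W. ip y G' \<xi> = differential M f y \<xi>" for G'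
  proof (rule ccontr)
    assume "G' \<noteq> G"
    have d: "G' - G \<in> ?W" using G(1) G'(1) W by (simp add: subspace_diff)
    have "ip y (G' - G) (G' - G) = ip y G' (G' - G) - ip y G (G' - G)"
      using lin[OF G'(1) G(1) d, of 1 "-1"] by simp
    also have "\<dots> = 0" using G'(2) G(2)[OF d] diff[OF d] d by simp
    finally show False using pos[OF d] \<open>G' \<noteq> G\<close> by simp
  qed
  have "rgrad M ip f y = G"
    unfolding rgrad_def
  proof (rule the_equality)
    show "G \<in> ?W \<and> (\<forall>\<xi>\<in>?W. ip y G \<xi> = differential M f y \<xi>)"
      using G diff by simp
  qed (use uniq in blast)
  then show ?thesis using G(1) by simp
qed

section \<open>A single inexact gradient step\<close>

text \<open>The first bound feeds the descent condition, the second the retraction bound. Both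
  follow by expanding squares. The condition \<open>e \<le> 2\<close> turns the quadratic error
  \<open>e\<^sup>2\<close> into \<open>2 * e\<close>, leaving the summable term
  \<open>\<tau> * e\<close>.\<close>

lemma inexact_gradient_step:
  assumes metric: "riemannian_metric M ip" and y: "y \<in> M"
    and W: "subspace (tangent_space M y)"
    and v: "v \<in> tangent_space M y" and G: "G \<in> tangent_space M y"
    and err: "rnorm ip y (v - G) \<le> e" and e: "0 < e" "e \<le> 2"
    and \<tau>: "0 < \<tau>" "L * \<tau> \<le> 1"
  shows "ip y G (- (\<tau> *\<^sub>R v)) + L / 2 * (rnorm ip y (- (\<tau> *\<^sub>R v)))\<^sup>2
      \<le> - (\<tau> / 2 * (rnorm ip y G)\<^sup>2) + \<tau> * e"
    and "rnorm ip y (- (\<tau> *\<^sub>R v)) \<le> 2 * (\<tau> * (rnorm ip y G + e))"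
proof -
  let ?W = "tangent_space M y"
  have sym: "\<And>u v. u \<in> ?W \<Longrightarrow> v \<in> ?W \<Longrightarrow> ip y u v = ip y v u"
    and lin: "\<And>u v w \<alpha> \<beta>. u \<in> ?W \<Longrightarrow> v \<in> ?W \<Longrightarrow> w \<in> ?W \<Longrightarrow>
      ip y (\<alpha> *\<^sub>R u + \<beta> *\<^sub>R v) w = \<alpha> * ip y u w + \<beta> * ip y v w"
    and pos: "\<And>u. u \<in> ?W \<Longrightarrow> u \<noteq> 0 \<Longrightarrow> ip y u u > 0"
    using metric y unfolding riemannian_metric_def by metis+
  have nonneg: "ip y u u \<ge> 0" if "u \<in> ?W" for u
    using pos[OF that] lin[OF that that that, of 0 0] by (cases "u = 0") auto
  \<comment> \<open>Instances of this one expansion give the squared norms of \<open>v - G\<close>,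
    of the step and of \<open>v - 2G\<close>.\<close>
  have quad: "ip y (\<alpha> *\<^sub>R v + \<beta> *\<^sub>R G) (\<alpha> *\<^sub>R v + \<beta> *\<^sub>R G)
      = \<alpha>\<^sup>2 * ip y v v + 2 * \<alpha> * \<beta> * ip y G v + \<beta>\<^sup>2 * ip y G G" for \<alpha> \<beta>
  proof -
    define h where "h = \<alpha> *\<^sub>R v + \<beta> *\<^sub>R G"
    have h: "h \<in> ?W" unfolding h_def using v G W by (simp add: subspace_add subspace_scale)
    have "ip y h h = \<alpha> * ip y h v + \<beta> * ip y h G"
      using lin[OF v G h, of \<alpha> \<beta>] sym[OF v h] sym[OF G h] by (simp add: h_def)
    also have "\<dots> = \<alpha>\<^sup>2 * ip y v v + 2 * \<alpha> * \<beta> * ip y G v + \<beta>\<^sup>2 * ip y G G"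
      using lin[OF v G v, of \<alpha> \<beta>] lin[OF v G G, of \<alpha> \<beta>] sym[OF v G]
      by (simp add: h_def power2_eq_square algebra_simps)
    finally show ?thesis by (simp add: h_def)
  qed
  have rnorm_sq: "(rnorm ip y u)\<^sup>2 = ip y u u" if "u \<in> ?W" for u
    using nonneg[OF that] by (simp add: rnorm_def)
  define a b c where "a = ip y G G" and "b = ip y v v" and "c = ip y G v"
  have a: "a \<ge> 0" and b: "b \<ge> 0" using nonneg[OF G] nonneg[OF v] by (simp_all add: a_def b_def)
  have vG: "v - G \<in> ?W" using v G W by (simp add: subspace_diff)
  have n: "b - 2 * c + a \<le> e\<^sup>2"
  proof -
    have "(rnorm ip y (v - G))\<^sup>2 \<le> e\<^sup>2"
      using err nonneg[OF vG] by (intro power_mono) (auto simp: rnorm_def)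
    then show ?thesis
      using rnorm_sq[OF vG] quad[of 1 "-1"] by (simp add: a_def b_def c_def)
  qed
  have step: "- (\<tau> *\<^sub>R v) \<in> ?W" using v W by (simp add: subspace_neg subspace_scale)
  have step_sq: "ip y (- (\<tau> *\<^sub>R v)) (- (\<tau> *\<^sub>R v)) = \<tau>\<^sup>2 * b"
    using quad[of "- \<tau>" 0] by (simp add: b_def)
  have "ip y G (- (\<tau> *\<^sub>R v)) = - \<tau> * c"
    using lin[OF v v G, of "- \<tau>" 0] sym[OF G step] sym[OF G v] by (simp add: c_def)
  moreover have "(rnorm ip y (- (\<tau> *\<^sub>R v)))\<^sup>2 = \<tau>\<^sup>2 * b"
    using rnorm_sq[OF step] step_sq by simp
  moreover have "- \<tau> * c + L / 2 * (\<tau>\<^sup>2 * b) \<le> - (\<tau> / 2 * a) + \<tau> * e"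
  proof -
    have "L / 2 * (\<tau>\<^sup>2 * b) = (L * \<tau>) * (\<tau> * b / 2)" by (simp add: power2_eq_square)
    also have "\<dots> \<le> 1 * (\<tau> * b / 2)" using \<tau> b by (intro mult_right_mono) auto
    \<comment> \<open>Completing the square: \<open>b - 2 * c + a\<close> is the squared norm of
      \<open>v - G\<close>.\<close>
    finally have "- \<tau> * c + L / 2 * (\<tau>\<^sup>2 * b) \<le> \<tau> / 2 * (b - 2 * c + a) - \<tau> / 2 * a"
      by (simp add: algebra_simps)
    also have "\<tau> / 2 * (b - 2 * c + a) \<le> \<tau> / 2 * (2 * e)"
    proof (rule mult_left_mono)
      have "e\<^sup>2 \<le> 2 * e" using e by (simp add: power2_eq_square)
      then show "b - 2 * c + a \<le> 2 * e" using n by simp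
    qed (use \<tau> in simp)
    finally show ?thesis by simp
  qed
  ultimately show "ip y G (- (\<tau> *\<^sub>R v)) + L / 2 * (rnorm ip y (- (\<tau> *\<^sub>R v)))\<^sup>2
      \<le> - (\<tau> / 2 * (rnorm ip y G)\<^sup>2) + \<tau> * e"
    using rnorm_sq[OF G] by (simp add: a_def)
  \<comment> \<open>Positivity at \<open>v - 2G\<close>, combined with twice the error bound
    \<open>n\<close>, eliminates \<open>c\<close> and replaces the triangle inequality. The
    resulting factor 2 in the bound for the step is harmless.\<close>
  have "0 \<le> b - 4 * c + 4 * a"
    using nonneg[of "1 *\<^sub>R v + (-2) *\<^sub>R G"] quad[of 1 "-2"] v G W
    by (simp add: a_def b_def c_def subspace_diff subspace_scale)
  then have "b \<le> 2 * a + 2 * e\<^sup>2" using n by linarith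
  also have "\<dots> \<le> (2 * (sqrt a + e))\<^sup>2"
  proof -
    have "(2 * (sqrt a + e))\<^sup>2 = 4 * a + 8 * (sqrt a * e) + 4 * e\<^sup>2"
      using a by (simp add: power2_eq_square algebra_simps)
    moreover have "0 \<le> sqrt a * e" using a e by simp
    ultimately show ?thesis using a zero_le_power2[of e] by linarith
  qed
  finally have "sqrt b \<le> 2 * (sqrt a + e)"
    using a e by (intro real_le_lsqrt) auto
  then have "\<tau> * sqrt b \<le> \<tau> * (2 * (sqrt a + e))"
    using \<tau> by (intro mult_left_mono) auto
  then show "rnorm ip y (- (\<tau> *\<^sub>R v)) \<le> 2 * (\<tau> * (rnorm ip y G + e))"
    using \<tau> step_sq by (simp add: rnorm_def a_def real_sqrt_mult)
qed

subsection \<open>Convergence from the KL inequality\<close>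

lemma infsum_atLeast_Suc:
  fixes a :: "nat \<Rightarrow> real"
  assumes "a summable_on {k..}"
  shows "infsum a {k..} = a k + infsum a {Suc k..}"
proof -
  have "{k..} = {k} \<union> {Suc k..}" by auto
  moreover have "infsum a ({k} \<union> {Suc k..}) = infsum a {k} + infsum a {Suc k..}"
    by (rule infsum_Un_disjoint) (auto intro: summable_on_subset_banach[OF assms])
  ultimately show ?thesis by simp
qed

lemma infsum_atLeast_tendsto_0:
  fixes a :: "nat \<Rightarrow> real"
  assumes "a summable_on {m..}"
  shows "(\<lambda>k. infsum a {k..}) \<longlonglongrightarrow> 0"
proof -
  \<comment> \<open>Splitting off \<open>n\<close> terms reduces the vanishing of tails to
    convergence of the partial sums of the series shifted by \<open>m\<close>.\<close>
  have tail: "infsum a {m..} = (\<Sum>i<n. a (i + m)) + infsum a {n + m..}" for n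
  proof (induction n)
    case (Suc n)
    have "a summable_on {n + m..}"
      by (rule summable_on_subset_banach[OF assms]) auto
    then show ?case using Suc infsum_atLeast_Suc by fastforce
  qed simp
  have bij: "bij_betw (\<lambda>i. i + m) UNIV {m..}"
    by (rule bij_betwI[where g = "\<lambda>i. i - m"]) auto
  have "((\<lambda>i. a (i + m)) has_sum infsum a {m..}) UNIV"
    using has_sum_reindex_bij_betw[OF bij, of a] has_sum_infsum[OF assms] by simp
  then have "(\<lambda>n. \<Sum>i<n. a (i + m)) \<longlonglongrightarrow> infsum a {m..}"
    using has_sum_imp_sums unfolding sums_def by blast
  then have "(\<lambda>n. infsum a {m..} - (\<Sum>i<n. a (i + m))) \<longlonglongrightarrow> 0"
    by (auto intro!: tendsto_eq_intros)
  moreover have "infsum a {n + m..} = infsum a {m..} - (\<Sum>i<n. a (i + m))" for n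
    using tail[of n] by simp
  ultimately have "(\<lambda>n. infsum a {n + m..}) \<longlonglongrightarrow> 0" by presburger
  then show ?thesis by (rule LIMSEQ_offset)
qed

lemma decreasing_tendsto_of_subseq:
  fixes D :: "nat \<Rightarrow> real"
  assumes "strict_mono s" "(D \<circ> s) \<longlonglongrightarrow> 0"
    and "\<And>k. k \<ge> N \<Longrightarrow> 0 \<le> D k" "\<And>k. k \<ge> N \<Longrightarrow> D (Suc k) \<le> D k"
  shows "D \<longlonglongrightarrow> 0"
proof (rule LIMSEQ_I)
  fix e :: real assume "e > 0"
  then have "\<forall>\<^sub>F j in sequentially. (D \<circ> s) j < e"
    using assms(2) by (intro order_tendstoD(2))
  moreover have "\<forall>\<^sub>F j in sequentially. j \<ge> N" by (rule eventually_ge_at_top)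
  ultimately have "\<forall>\<^sub>F j in sequentially. (D \<circ> s) j < e \<and> j \<ge> N" by eventually_elim auto
  then obtain j where j: "D (s j) < e" "j \<ge> N"
    unfolding eventually_sequentially by auto
  have sj: "s j \<ge> N" using strict_mono_imp_increasing[OF assms(1), of j] j(2) by simp
  have "norm (D k - 0) < e" if "k \<ge> s j" for k
  proof -
    have "D k \<le> D (s j)"
      using that
    proof (induction k rule: dec_induct)
      case (step i)
      then show ?case using assms(4)[of i] sj by linarith
    qed simp
    then show ?thesis using j assms(3)[of k] that sj by simp
  qed
  then show "\<exists>n0. \<forall>k\<ge>n0. norm (D k - 0) < e" by blast
qed

text \<open>The step estimate holds only near \<open>z\<close>, so staying near \<open>z\<close> has
  to be carried along in the induction. From an iterate close to \<open>z\<close> with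
  \<open>E\<close> small, telescoping bounds the total later displacement by the remaining value of
  \<open>E\<close>.\<close>

lemma trapped_sequence_convergent:
  fixes x :: "nat \<Rightarrow> 'a::metric_space"
  assumes "strict_mono s" "(x \<circ> s) \<longlonglongrightarrow> z"
    and "r > 0" "E \<longlonglongrightarrow> 0" "\<And>k. k \<ge> N \<Longrightarrow> 0 \<le> E k"
    and step: "\<And>k. k \<ge> N \<Longrightarrow> dist (x k) z < r \<Longrightarrow> dist (x (Suc k)) (x k) \<le> E k - E (Suc k)"
  shows "x \<longlonglongrightarrow> z"
proof (rule metric_LIMSEQ_I)
  fix e :: real assume "e > 0"
  \<comment> \<open>Half of \<open>\<rho>\<close> is spent on the distance of the starting iterate
    from \<open>z\<close>, half on the later displacement; \<open>\<rho> \<le> r\<close> keeps the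
    step estimate available.\<close>
  define \<rho> where "\<rho> = min e r"
  have "\<rho> > 0" using \<open>e > 0\<close> assms(3) by (simp add: \<rho>_def)
  have "\<forall>\<^sub>F j in sequentially. E (s j) < \<rho> / 2"
    using LIMSEQ_subseq_LIMSEQ[OF assms(4,1)] \<open>\<rho> > 0\<close>
    unfolding o_def by (intro order_tendstoD(2)) auto
  moreover have "\<forall>\<^sub>F j in sequentially. dist (x (s j)) z < \<rho> / 2"
    using tendstoD[OF assms(2), of "\<rho> / 2"] \<open>\<rho> > 0\<close> by (simp add: o_def)
  moreover have "\<forall>\<^sub>F j in sequentially. j \<ge> N" by (rule eventually_ge_at_top)
  ultimately have "\<forall>\<^sub>F j in sequentially. E (s j) < \<rho> / 2 \<and> dist (x (s j)) z < \<rho> / 2 \<and> j \<ge> N"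
    by eventually_elim auto
  then obtain j where j: "E (s j) < \<rho> / 2" "dist (x (s j)) z < \<rho> / 2" "j \<ge> N"
    unfolding eventually_sequentially by auto
  define m where "m = s j"
  have m: "m \<ge> N" using strict_mono_imp_increasing[OF assms(1), of j] j(3) by (simp add: m_def)
  have close: "dist (x k) z < \<rho>" if "dist (x k) (x m) \<le> E m - E k" "k \<ge> m" for k
    using dist_triangle[of "x k" z "x m"] that j(1,2) assms(5)[of k] m by (simp add: m_def)
  have "dist (x k) (x m) \<le> E m - E k" if "k \<ge> m" for k
    using that
  proof (induction k rule: dec_induct)
    case (step k)
    have "dist (x k) z < r" using close[OF step.IH step.hyps(1)] by (simp add: \<rho>_def)
    then show ?case
      using assms(6)[of k] step m dist_triangle[of "x (Suc k)" "x m" "x k"] by simp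
  qed simp
  then show "\<exists>n0. \<forall>k\<ge>n0. dist (x k) z < e"
    using close by (metis \<rho>_def min_less_iff_conj)
qed

section \<open>Desingularizing functions and the abstract KL argument\<close>

text \<open>A concave function lies below its tangents. The point of tangency must be interior to
  the domain, whereas \<open>b\<close> may be the endpoint 0.\<close>

lemma desingularizing_tangent:
  assumes "desingularizing \<delta> \<phi>" "0 < a" "ereal a < \<delta>" "0 \<le> b" "ereal b < \<delta>"
  shows "\<phi> b \<le> \<phi> a + deriv \<phi> a * (b - a)"
proof -
  let ?A = "{s. 0 \<le> s \<and> ereal s < \<delta>}"
  have conv: "convex_on ?A (\<lambda>s. - \<phi> s)" and diff: "\<phi> differentiable (at a)"
    using assms(1-3) unfolding desingularizing_def concave_on_def by auto
  have "open {s. 0 < s \<and> ereal s < \<delta>}"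
    by (cases \<delta>) (auto simp: open_Collect_less open_Collect_conj)
  moreover have "{s. 0 < s \<and> ereal s < \<delta>} \<subseteq> ?A" by auto
  ultimately have a: "a \<in> interior ?A"
    using assms(2,3) by (auto intro: interiorI)
  have "(\<phi> has_real_derivative deriv \<phi> a) (at a)"
    using diff DERIV_deriv_iff_real_differentiable by blast
  then have "((\<lambda>s. - \<phi> s) has_real_derivative - deriv \<phi> a) (at a within ?A)"
    by (intro DERIV_minus) (rule has_field_derivative_at_within)
  from convex_on_imp_above_tangent[OF conv _ a _ this, of b]
  show ?thesis
    using convex_connected[OF convex_on_imp_convex[OF conv]] assms(4,5)
    by (simp add: algebra_simps)
qed

text \<open>Concavity turns the decrease from \<open>D\<close> to \<open>D'\<close> into a gain of
  at least \<open>p * \<tau> / 2 * G\<^sup>2\<close> in \<open>\<phi>\<close>, where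
  \<open>p\<close> is the slope at \<open>D\<close>. The hypothesis \<open>KL\<close> bounds
  \<open>p\<close> from below by \<open>C / (G + w)\<close> when \<open>G + w\<close> is positive;
  combining the two trades \<open>G\<^sup>2\<close> for \<open>G\<close>.\<close>

lemma KL_step_bound:
  assumes des: "desingularizing \<delta> \<phi>" and "0 < D" "ereal D < \<delta>" "0 < D'"
    and pos: "0 \<le> G" "0 \<le> w" "0 < \<tau>" "0 < C"
    and KL: "C * inverse (deriv \<phi> D) \<le> G + w"
    and decr: "D' \<le> D - \<tau> / 2 * G\<^sup>2"
  shows "\<tau> * G \<le> 2 / C * (\<phi> D - \<phi> D') + \<tau> * w"
proof -
  define p where "p = deriv \<phi> D"
  have p: "p > 0" using des assms(2,3) unfolding p_def desingularizing_def by auto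
  have "D' \<le> D" using decr pos(3) by (smt (verit) mult_nonneg_nonneg zero_le_power2 divide_nonneg_nonneg)
  then have "ereal D' < \<delta>" using assms(3) by (metis ereal_less_eq(3) order_le_less_trans)
  then have "\<phi> D' \<le> \<phi> D + p * (D' - D)"
    unfolding p_def using assms by (intro desingularizing_tangent[OF des]) auto
  also have "\<dots> \<le> \<phi> D - p * (\<tau> / 2 * G\<^sup>2)"
    using mult_left_mono[OF decr, of p] p by (simp add: algebra_simps)
  finally have dec: "p * (\<tau> / 2 * G\<^sup>2) \<le> \<phi> D - \<phi> D'" by simp
  have Cp: "C \<le> p * (G + w)"
    using KL p by (simp add: p_def[symmetric] field_simps)
  \<comment> \<open>Multiplying \<open>Cp\<close> by \<open>G - w\<close> makes the difference of
    squares appear, so no division by \<open>G + w\<close> occurs. If \<open>w > G\<close> the left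
    side is not positive.\<close>
  have "C * (G - w) \<le> p * G\<^sup>2"
  proof (cases "w \<le> G")
    case True
    then have "C * (G - w) \<le> p * (G + w) * (G - w)"
      using Cp by (intro mult_right_mono) auto
    also have "\<dots> = p * (G\<^sup>2 - w\<^sup>2)" by (simp add: power2_eq_square algebra_simps)
    also have "\<dots> \<le> p * G\<^sup>2" using p by (intro mult_left_mono) auto
    finally show ?thesis .
  next
    case False
    then have "C * (G - w) \<le> 0" using pos by (simp add: mult_le_0_iff)
    also have "0 \<le> p * G\<^sup>2" using p by simp
    finally show ?thesis .
  qed
  then have "\<tau> / 2 * (C * (G - w)) \<le> \<tau> / 2 * (p * G\<^sup>2)"
    using pos(3) by (intro mult_left_mono) auto
  also have "\<dots> \<le> \<phi> D - \<phi> D'" using dec by (simp add: mult.left_commute)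
  finally show ?thesis using pos(4) by (simp add: field_simps)
qed

text \<open>The convergence argument detached from geometry: \<open>F\<close> stands for the gap in
  function value, \<open>G\<close> for the gradient norm, and the points live in any metric space.
  \<open>F\<close> itself need not decrease; adding the remaining error \<open>u\<close> makes it
  monotone.\<close>

lemma KL_sequence_convergent:
  fixes x :: "nat \<Rightarrow> 'a::metric_space" and F G t \<epsilon> :: "nat \<Rightarrow> real"
  defines "u \<equiv> \<lambda>k. \<Sum>\<^sub>\<infinity>i\<in>{k..}. t i * \<epsilon> i"
  assumes des: "desingularizing \<delta> \<phi>"
    and t_pos: "\<And>k. k \<ge> 1 \<Longrightarrow> t k > 0" and eps_pos: "\<And>k. k \<ge> 1 \<Longrightarrow> \<epsilon> k > 0"
    and t_eps: "(\<lambda>k. t k * \<epsilon> k) summable_on {1..}"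
    and phi_sum: "(\<lambda>k. t k * inverse (deriv \<phi> (u k))) summable_on {k. k \<ge> 1 \<and> ereal (u k) < \<delta>}"
    and C_pos: "C > 0"
    and quasi: "\<And>a b. 0 < a \<Longrightarrow> 0 < b \<Longrightarrow> ereal (a + b) < \<delta> \<Longrightarrow>
      C * inverse (deriv \<phi> (a + b)) \<le> inverse (deriv \<phi> a) + inverse (deriv \<phi> b)"
    and F_pos: "\<forall>\<^sub>F k in sequentially. F k > 0"
    and G_nonneg: "\<And>k. k \<ge> 1 \<Longrightarrow> G k \<ge> 0"
    and decr: "\<forall>\<^sub>F k in sequentially. F (Suc k) \<le> F k - t k / 2 * (G k)\<^sup>2 + t k * \<epsilon> k"
    and step: "\<forall>\<^sub>F k in sequentially. dist (x (Suc k)) (x k) \<le> K * (t k * (G k + \<epsilon> k))"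
    and K_pos: "K > 0" and r_pos: "r > 0"
    and KL: "\<And>k. k \<ge> 1 \<Longrightarrow> dist (x k) z < r \<Longrightarrow> 0 < F k \<Longrightarrow> ereal (F k) < \<delta> \<Longrightarrow>
      deriv \<phi> (F k) * G k \<ge> 1"
    and sub: "strict_mono s" "(x \<circ> s) \<longlonglongrightarrow> z" "(F \<circ> s) \<longlonglongrightarrow> 0"
  shows "x \<longlonglongrightarrow> z"
proof -
  define w where "w k = inverse (deriv \<phi> (u k))" for k
  define W where "W k = (\<Sum>\<^sub>\<infinity>i\<in>{k..}. t i * w i)" for k
  define \<Delta> where "\<Delta> k = F k + u k" for k
  have \<delta>: "\<delta> > 0" and \<phi>0: "\<phi> 0 = 0"
    and \<phi>_nonneg: "\<And>s. 0 \<le> s \<Longrightarrow> ereal s < \<delta> \<Longrightarrow> \<phi> s \<ge> 0"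
    and \<phi>'_pos: "\<And>s. 0 < s \<Longrightarrow> ereal s < \<delta> \<Longrightarrow> deriv \<phi> s > 0"
    and \<phi>_cont: "continuous_on {s. 0 \<le> s \<and> ereal s < \<delta>} \<phi>"
    using des unfolding desingularizing_def by auto
  have small: "\<forall>\<^sub>F k in sequentially. ereal (h k) < \<delta>" if "h \<longlonglongrightarrow> 0" for h :: "nat \<Rightarrow> real"
  proof -
    have "(\<lambda>k. ereal (h k)) \<longlonglongrightarrow> ereal 0" using that by simp
    then show ?thesis using \<delta> by (intro order_tendstoD(2)) (auto simp: zero_ereal_def)
  qed
  have u_lim: "u \<longlonglongrightarrow> 0" unfolding u_def by (rule infsum_atLeast_tendsto_0[OF t_eps])
  have u_Suc: "u k = t k * \<epsilon> k + u (Suc k)" if "k \<ge> 1" for k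
    unfolding u_def by (rule infsum_atLeast_Suc, rule summable_on_subset_banach[OF t_eps]) (use that in auto)
  have te_pos: "t k * \<epsilon> k > 0" if "k \<ge> 1" for k
    using t_pos[OF that] eps_pos[OF that] by simp
  have u_nonneg: "u k \<ge> 0" if "k \<ge> 1" for k
    unfolding u_def by (rule infsum_nonneg) (use te_pos that in \<open>simp add: less_imp_le\<close>)
  \<comment> \<open>Strictness matters: \<open>quasi\<close> is later applied to \<open>F k\<close>
    and \<open>u k\<close>, both of which must be positive.\<close>
  have u_pos: "u k > 0" if "k \<ge> 1" for k
    using u_Suc[OF that] te_pos[OF that] u_nonneg[of "Suc k"] by simp
  have "\<forall>\<^sub>F k in sequentially. k \<ge> 1 \<and> F k > 0 \<and> ereal (u k) < \<delta> \<and>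
      F (Suc k) \<le> F k - t k / 2 * (G k)\<^sup>2 + t k * \<epsilon> k"
    using eventually_ge_at_top[of 1] F_pos small[OF u_lim] decr by eventually_elim auto
  then obtain N where N: "\<And>k. k \<ge> N \<Longrightarrow> k \<ge> 1" "\<And>k. k \<ge> N \<Longrightarrow> F k > 0"
    "\<And>k. k \<ge> N \<Longrightarrow> ereal (u k) < \<delta>"
    "\<And>k. k \<ge> N \<Longrightarrow> F (Suc k) \<le> F k - t k / 2 * (G k)\<^sup>2 + t k * \<epsilon> k"
    unfolding eventually_sequentially by metis
  have \<Delta>_pos: "\<Delta> k > 0" if "k \<ge> N" for k
    using N(1,2)[OF that] u_pos by (simp add: \<Delta>_def add_pos_pos)
  have \<Delta>_decr: "\<Delta> (Suc k) \<le> \<Delta> k - t k / 2 * (G k)\<^sup>2" if "k \<ge> N" for k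
    using N(4)[OF that] u_Suc[OF N(1)[OF that]] by (simp add: \<Delta>_def)
  have \<Delta>_mono: "\<Delta> (Suc k) \<le> \<Delta> k" if "k \<ge> N" for k
  proof -
    have "0 \<le> t k / 2 * (G k)\<^sup>2" using t_pos[OF N(1)[OF that]] by simp
    then show ?thesis using \<Delta>_decr[OF that] by linarith
  qed
  have "(\<lambda>j. F (s j) + u (s j)) \<longlonglongrightarrow> 0 + 0"
    using sub(3) LIMSEQ_subseq_LIMSEQ[OF u_lim sub(1)] unfolding o_def by (rule tendsto_add)
  then have "(\<Delta> \<circ> s) \<longlonglongrightarrow> 0" by (simp add: \<Delta>_def o_def)
  then have \<Delta>_lim: "\<Delta> \<longlonglongrightarrow> 0"
    using decreasing_tendsto_of_subseq[OF sub(1), of \<Delta> N] \<Delta>_pos \<Delta>_mono by (simp add: less_imp_le)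
  have "\<forall>\<^sub>F k in sequentially. k \<ge> N \<and> ereal (\<Delta> k) < \<delta> \<and>
      dist (x (Suc k)) (x k) \<le> K * (t k * (G k + \<epsilon> k))"
    using eventually_ge_at_top[of N] small[OF \<Delta>_lim] step by eventually_elim auto
  then obtain N' where N': "\<And>k. k \<ge> N' \<Longrightarrow> k \<ge> N" "\<And>k. k \<ge> N' \<Longrightarrow> ereal (\<Delta> k) < \<delta>"
    "\<And>k. k \<ge> N' \<Longrightarrow> dist (x (Suc k)) (x k) \<le> K * (t k * (G k + \<epsilon> k))"
    unfolding eventually_sequentially by metis
  have w_pos: "w k > 0" if "k \<ge> N" for k
    unfolding w_def using \<phi>'_pos[OF u_pos[OF N(1)[OF that]] N(3)[OF that]] by simp
  \<comment> \<open>From \<open>N\<close> on \<open>u k\<close> stays below \<open>\<delta>\<close>,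
    so the whole tail lies in the index set of \<open>phi_sum\<close>.\<close>
  have sumW: "(\<lambda>k. t k * w k) summable_on {k..}" if "k \<ge> N" for k
    unfolding w_def by (rule summable_on_subset_banach[OF phi_sum]) (use that N in auto)
  have W_lim: "W \<longlonglongrightarrow> 0"
    unfolding W_def by (rule infsum_atLeast_tendsto_0[OF sumW[OF order_refl]])
  have W_Suc: "W k = t k * w k + W (Suc k)" if "k \<ge> N" for k
    unfolding W_def by (rule infsum_atLeast_Suc[OF sumW[OF that]])
  have W_nonneg: "W k \<ge> 0" if "k \<ge> N" for k
    unfolding W_def
    by (rule infsum_nonneg) (use that w_pos t_pos N(1) in \<open>auto intro!: mult_nonneg_nonneg less_imp_le\<close>)
  have \<phi>_lim: "(\<lambda>k. \<phi> (\<Delta> k)) \<longlonglongrightarrow> 0"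
  proof -
    have "\<forall>\<^sub>F k in sequentially. \<Delta> k \<in> {s. 0 \<le> s \<and> ereal s < \<delta>}"
      unfolding eventually_sequentially using N' \<Delta>_pos by (intro exI[of _ N']) (auto simp: less_imp_le)
    from continuous_on_tendsto_compose[OF \<phi>_cont \<Delta>_lim _ this]
    show ?thesis using \<delta> \<phi>0 by (simp add: zero_ereal_def)
  qed
  \<comment> \<open>The potential for the trapping argument: the drop of the first two terms pays
    for \<open>t k * G k\<close>, that of \<open>u\<close> for
    \<open>t k * \<epsilon> k\<close>.\<close>
  define E where "E k = K * (2 / C * \<phi> (\<Delta> k) + W k + u k)" for k
  show ?thesis
  proof (rule trapped_sequence_convergent[OF sub(1,2) r_pos])
    have "(\<lambda>k. K * (2 / C * \<phi> (\<Delta> k) + W k + u k)) \<longlonglongrightarrow> K * (2 / C * 0 + 0 + 0)"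
      by (intro tendsto_intros \<phi>_lim W_lim u_lim)
    then show "E \<longlonglongrightarrow> 0" by (simp add: E_def[abs_def])
    show "0 \<le> E k" if "k \<ge> N'" for k
      unfolding E_def using K_pos C_pos \<phi>_nonneg[of "\<Delta> k"] N'[OF that] \<Delta>_pos[of k] W_nonneg[of k]
        u_nonneg[of k] N(1)[of k]
      by (simp add: less_imp_le)
    show "dist (x (Suc k)) (x k) \<le> E k - E (Suc k)" if k: "k \<ge> N'" and near: "dist (x k) z < r" for k
    proof -
      note kN = N'(1)[OF k]
      note k1 = N(1)[OF kN]
      have F: "0 < F k" "ereal (F k) < \<delta>"
        using N(2)[OF kN] N'(2)[OF k] u_pos[OF k1]
        by (auto simp: \<Delta>_def intro: order_less_trans[of _ "ereal (F k + u k)"])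
      have "inverse (deriv \<phi> (F k)) \<le> G k"
        using KL[OF k1 near F] \<phi>'_pos[OF F] by (simp add: field_simps)
      moreover have "C * inverse (deriv \<phi> (\<Delta> k)) \<le> inverse (deriv \<phi> (F k)) + w k"
        unfolding \<Delta>_def w_def
        by (rule quasi) (use F u_pos[OF k1] N'(2)[OF k] in \<open>auto simp: \<Delta>_def\<close>)
      ultimately have "C * inverse (deriv \<phi> (\<Delta> k)) \<le> G k + w k" by simp
      then have "t k * G k \<le> 2 / C * (\<phi> (\<Delta> k) - \<phi> (\<Delta> (Suc k))) + t k * w k"
        using \<Delta>_pos[of "Suc k"] kN
        by (intro KL_step_bound[OF des \<Delta>_pos[OF kN] N'(2)[OF k] _ G_nonneg[OF k1] less_imp_le[OF w_pos[OF kN]]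
              t_pos[OF k1] C_pos _ \<Delta>_decr[OF kN]]) auto
      then have "t k * (G k + \<epsilon> k) \<le>
          2 / C * (\<phi> (\<Delta> k) - \<phi> (\<Delta> (Suc k))) + (W k - W (Suc k)) + (u k - u (Suc k))"
        using W_Suc[OF kN] u_Suc[OF k1] by (simp add: algebra_simps)
      then have "K * (t k * (G k + \<epsilon> k)) \<le> E k - E (Suc k)"
        using mult_left_mono[OF _ less_imp_le[OF K_pos]] unfolding E_def by (fastforce simp: algebra_simps)
      then show ?thesis using N'(3)[OF k] by linarith
    qed
  qed
qed

subsection \<open>Inexact Riemannian gradient descent\<close>

theorem theorem3p11:
  fixes M :: "(real ^ 'n) set"
    and ip :: "real ^ 'n \<Rightarrow> real ^ 'n \<Rightarrow> real ^ 'n \<Rightarrow> real"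
    and R :: "real ^ 'n \<Rightarrow> real ^ 'n \<Rightarrow> real ^ 'n"
    and T :: "real ^ 'n \<Rightarrow> real ^ 'n \<Rightarrow> real ^ 'n \<Rightarrow> real ^ 'n"
    and f :: "real ^ 'n \<Rightarrow> real"
    and \<kappa> L C :: real
    and t \<epsilon> :: "nat \<Rightarrow> real"
    and x g :: "nat \<Rightarrow> real ^ 'n"
    and xbar :: "real ^ 'n"
    and \<delta> :: ereal
    and \<phi> :: "real \<Rightarrow> real"
  assumes manifold: "embedded_submanifold M"
    and metric: "riemannian_metric M ip"
    and retraction: "manifold_retraction M R"
    and kappa_pos: "\<kappa> > 0"
    and retraction_bound:
      "\<And>y \<eta>. y \<in> M \<Longrightarrow> \<eta> \<in> tangent_space M y \<Longrightarrow> norm (R y \<eta> - y) \<le> \<kappa> * rnorm ip y \<eta>"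
    and transport: "vector_transport M R T" "isometric_transport M ip R T"
    and f_C1: "C_map 1 M f"
    and L_pos: "L > 0"
    and descent: "\<And>y \<eta>. y \<in> M \<Longrightarrow> \<eta> \<in> tangent_space M y \<Longrightarrow>
      f (R y \<eta>) \<le> f y + ip y (rgrad M ip f y) \<eta> + L / 2 * (rnorm ip y \<eta>)\<^sup>2"
    and lipschitz: "\<And>y \<eta>. y \<in> M \<Longrightarrow> \<eta> \<in> tangent_space M y \<Longrightarrow>
      rnorm ip y (back_transport M T y \<eta> (rgrad M ip f (R y \<eta>)) - rgrad M ip f y)
        \<le> L * rnorm ip y \<eta>"
    and t_pos: "\<And>k. k \<ge> 1 \<Longrightarrow> t k > 0"
    and eps_pos: "\<And>k. k \<ge> 1 \<Longrightarrow> \<epsilon> k > 0"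
    and t_sum: "filterlim (\<lambda>n. \<Sum>k=1..n. t k) at_top sequentially"
    and t_decreasing: "\<And>k. k \<ge> 1 \<Longrightarrow> t (Suc k) \<le> t k"
    and t_lim: "t \<longlonglongrightarrow> 0"
    and t_eps_sum: "(\<lambda>k. t k * \<epsilon> k) summable_on {1..}"
    and eps_limsup: "limsup (\<lambda>k. ereal (\<epsilon> k)) < 2"
    and x_in: "\<And>k. k \<ge> 1 \<Longrightarrow> x k \<in> M"
    and g_tangent: "\<And>k. k \<ge> 1 \<Longrightarrow> g k \<in> tangent_space M (x k)"
    and g_approx: "\<And>k. k \<ge> 1 \<Longrightarrow> rnorm ip (x k) (g k - rgrad M ip f (x k)) \<le> \<epsilon> k"
    and x_step: "\<And>k. k \<ge> 1 \<Longrightarrow> x (Suc k) = R (x k) (- (t k *\<^sub>R g k))"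
    and f_bdd: "bdd_below ((\<lambda>k. f (x k)) ` {1..})"
    and xbar: "xbar \<in> accumulation_points M x"
    and KL: "\<And>z. z \<in> accumulation_points M x \<Longrightarrow> riemannian_KL_with M ip f z \<delta> \<phi>"
    and C_pos: "C > 0"
    and phi_quasi: "\<And>a b. 0 < a \<Longrightarrow> 0 < b \<Longrightarrow> ereal (a + b) < \<delta> \<Longrightarrow>
      C * inverse (deriv \<phi> (a + b)) \<le> inverse (deriv \<phi> a) + inverse (deriv \<phi> b)"
    and phi_sum: "(\<lambda>k. t k * inverse (deriv \<phi> (\<Sum>\<^sub>\<infinity>i\<in>{k..}. t i * \<epsilon> i)))
      summable_on {k. k \<ge> 1 \<and> ereal (\<Sum>\<^sub>\<infinity>i\<in>{k..}. t i * \<epsilon> i) < \<delta>}"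
  shows "((\<forall>\<^sub>F k in sequentially. f (x k) > f xbar) \<longrightarrow> x \<longlonglongrightarrow> xbar) \<and>
    ((\<forall>y\<in>M. f xbar \<le> f y) \<longrightarrow> (\<exists>k\<ge>1. f (x k) = f xbar) \<or> x \<longlonglongrightarrow> xbar)"
proof -
  have W: "subspace (tangent_space M y)" if "y \<in> M" for y
    by (rule tangent_space_subspace[OF manifold that])
  have grad: "rgrad M ip f y \<in> tangent_space M y" if "y \<in> M" for y
    by (rule rgrad_in_tangent_space[OF manifold metric f_C1 that])
  have xbar_M: "xbar \<in> M" using xbar unfolding accumulation_points_def by blast
  obtain s where s: "strict_mono s" "(x \<circ> s) \<longlonglongrightarrow> xbar"
    using xbar unfolding accumulation_points_def by blast
  have des: "desingularizing \<delta> \<phi>"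
    using KL[OF xbar] unfolding riemannian_KL_with_def by blast
  obtain U where U: "openin (top_of_set M) U" "xbar \<in> U"
    "\<forall>y\<in>U. f xbar < f y \<and> ereal (f y) < ereal (f xbar) + \<delta> \<longrightarrow>
      deriv \<phi> (f y - f xbar) * rnorm ip y (rgrad M ip f y) \<ge> 1"
    using KL[OF xbar] unfolding riemannian_KL_with_def by blast
  obtain r where r: "r > 0" "ball xbar r \<inter> M \<subseteq> U"
    using U(1,2) unfolding openin_contains_ball by blast
  define G where "G k = rnorm ip (x k) (rgrad M ip f (x k))" for k
  define F where "F k = f (x k) - f xbar" for k
  \<comment> \<open>\<open>sqrt\<close> is negative on negative numbers, so positivity of the metric
    enters; its value at the zero vector comes from linearity with zero coefficients.\<close>
  have G_nonneg: "G k \<ge> 0" if "k \<ge> 1" for k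
  proof -
    define v where "v = rgrad M ip f (x k)"
    have v: "v \<in> tangent_space M (x k)" using grad[OF x_in[OF that]] by (simp add: v_def)
    have "v \<noteq> 0 \<Longrightarrow> ip (x k) v v > 0" "ip (x k) (0 *\<^sub>R v + 0 *\<^sub>R v) v = 0 * ip (x k) v v + 0 * ip (x k) v v"
      using metric v x_in[OF that] unfolding riemannian_metric_def by blast+
    then show ?thesis by (cases "v = 0") (simp_all add: G_def v_def[symmetric] rnorm_def)
  qed
  have "(\<lambda>k. L * t k) \<longlonglongrightarrow> L * 0" by (intro tendsto_intros t_lim)
  then have "\<forall>\<^sub>F k in sequentially. L * t k < 1" by (intro order_tendstoD(2)) auto
  moreover have "\<forall>\<^sub>F k in sequentially. ereal (\<epsilon> k) < 2"
    by (rule Limsup_lessD[OF eps_limsup])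
  \<comment> \<open>The smallness conditions of \<open>inexact_gradient_step\<close>: the vanishing
    step sizes give the bound on \<open>L * t k\<close>, the limsup condition the one on
    \<open>\<epsilon> k\<close>.\<close>
  ultimately have ev: "\<forall>\<^sub>F k in sequentially. k \<ge> 1 \<and> L * t k \<le> 1 \<and> \<epsilon> k \<le> 2"
    using eventually_ge_at_top[of 1]
    by eventually_elim (simp add: order_less_imp_le)
  have decr: "\<forall>\<^sub>F k in sequentially. F (Suc k) \<le> F k - t k / 2 * (G k)\<^sup>2 + t k * \<epsilon> k"
    using ev
  proof eventually_elim
    case (elim k)
    then have k: "k \<ge> 1" by blast
    note xk = x_in[OF k] and gk = g_tangent[OF k]
    have "- (t k *\<^sub>R g k) \<in> tangent_space M (x k)"
      using gk W[OF xk] by (simp add: subspace_neg subspace_scale)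
    from descent[OF xk this]
      inexact_gradient_step(1)[OF metric xk W[OF xk] gk grad[OF xk] g_approx[OF k] eps_pos[OF k]
        _ t_pos[OF k], of L] elim
    show ?case by (simp add: F_def G_def x_step[OF k])
  qed
  have step: "\<forall>\<^sub>F k in sequentially. dist (x (Suc k)) (x k) \<le> \<kappa> * 2 * (t k * (G k + \<epsilon> k))"
    using ev
  proof eventually_elim
    case (elim k)
    then have k: "k \<ge> 1" by blast
    note xk = x_in[OF k] and gk = g_tangent[OF k]
    have "- (t k *\<^sub>R g k) \<in> tangent_space M (x k)"
      using gk W[OF xk] by (simp add: subspace_neg subspace_scale)
    from retraction_bound[OF xk this]
    have "dist (x (Suc k)) (x k) \<le> \<kappa> * rnorm ip (x k) (- (t k *\<^sub>R g k))"
      by (simp add: dist_norm x_step[OF k])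
    also have "\<dots> \<le> \<kappa> * (2 * (t k * (G k + \<epsilon> k)))"
      unfolding G_def
      using inexact_gradient_step(2)[OF metric xk W[OF xk] gk grad[OF xk] g_approx[OF k] eps_pos[OF k]
        _ t_pos[OF k], of L] elim kappa_pos
      by (intro mult_left_mono) auto
    finally show ?case by simp
  qed
  \<comment> \<open>\<open>f\<close> is regular only on \<open>M\<close>, so continuity is taken
    from a local extension \<open>h\<close>. Since \<open>x 0\<close> may lie outside
    \<open>M\<close>, only indices with \<open>s j \<ge> 1\<close> are compared.\<close>
  have sub: "(F \<circ> s) \<longlonglongrightarrow> 0"
  proof -
    obtain V h where h: "open V" "xbar \<in> V" "C_on 1 h V" "\<forall>y\<in>V \<inter> M. h y = f y"
      using f_C1 xbar_M unfolding C_map_def by metis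
    have "isCont h xbar"
      using C_on_differentiable[OF h(3) _ h(2)] by (simp add: differentiable_imp_continuous_within)
    then have "(\<lambda>j. h ((x \<circ> s) j)) \<longlonglongrightarrow> h xbar"
      using s(2) by (rule isCont_tendsto_compose)
    moreover have "\<forall>\<^sub>F j in sequentially. h ((x \<circ> s) j) = f ((x \<circ> s) j)"
      using topological_tendstoD[OF s(2) h(1,2)] eventually_ge_at_top[of 1]
    proof eventually_elim
      case (elim j)
      have "s j \<ge> 1" using strict_mono_imp_increasing[OF s(1), of j] elim(2) by simp
      then show ?case using elim(1) h(4) x_in by simp
    qed
    ultimately have "(\<lambda>j. f ((x \<circ> s) j)) \<longlonglongrightarrow> f xbar"
      using h(2,4) xbar_M by (simp add: tendsto_cong)
    then show ?thesis by (simp add: F_def o_def LIM_zero)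
  qed
  have conv: "x \<longlonglongrightarrow> xbar" if above: "\<forall>\<^sub>F k in sequentially. f (x k) > f xbar"
  proof (rule KL_sequence_convergent[where F = F and G = G and K = "\<kappa> * 2",
        OF des t_pos eps_pos t_eps_sum phi_sum C_pos phi_quasi _ G_nonneg decr step _ r(1) _ s sub])
    show "\<forall>\<^sub>F k in sequentially. 0 < F k"
      using above by eventually_elim (simp add: F_def)
    show "1 \<le> deriv \<phi> (F k) * G k"
      if k: "k \<ge> 1" and near: "dist (x k) xbar < r" and F: "0 < F k" "ereal (F k) < \<delta>" for k
    proof -
      have "x k \<in> U" using r(2) near x_in[OF k] by (auto simp: dist_commute)
      moreover have "ereal (f (x k)) < ereal (f xbar) + \<delta>"
        using F(2) by (cases \<delta>) (auto simp: F_def)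
      ultimately show ?thesis using U(3) F(1) by (simp add: F_def G_def)
    qed
  qed (use kappa_pos in auto)
  \<comment> \<open>Minimality together with no equality along the iterates yields the strict
    inequality required by \<open>conv\<close>.\<close>
  moreover have "x \<longlonglongrightarrow> xbar" if "\<forall>y\<in>M. f xbar \<le> f y" "\<not> (\<exists>k\<ge>1. f (x k) = f xbar)"
  proof (rule conv)
    show "\<forall>\<^sub>F k in sequentially. f (x k) > f xbar"
      using eventually_ge_at_top[of 1]
      by eventually_elim (use that x_in in \<open>metis order_le_imp_less_or_eq\<close>)
  qed
  ultimately show ?thesis by blast
qed

end
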